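(* Let $\mathcal{H}\cong\mathbb{C}^n$ and let $\mathbf{v}$ be a self-adjoint operator on $\mathcal{H}$. Let $\Gamma$ be the GKLS vector field on $\mathfrak{T}_1$ of the quantum Gaussian semigroup with generator $\mathbf{L}(\xi)=-\mathbf{v}^2\odot\xi+\mathbf{v}\,\xi\,\mathbf{v}$, that is, $$\Gamma=\left(\mathrm{Tr}\left(\mathbf{v}\,\xi\,\mathbf{v}\,\mathbf{e}^k\right)-\mathrm{Tr}\left((\mathbf{v}^2\odot\xi)\,\mathbf{e}^k\right)\right)\frac{\partial}{\partial x^k}.$$ Then the function $F(\xi)=\frac12\mathrm{Tr}(\xi^2)$ is a LaSalle function for $\Gamma$.
   Context: $\mathfrak{O}^*$ is the space of self-adjoint $n\times n$ matrices (identified with the dual of the space $\mathfrak{O}$ of self-adjoint operators on $\mathcal{H}$ via the trace), $\mathfrak{T}_1=\{\xi\in\mathfrak{O}^*:\mathrm{Tr}\,\xi=1\}$, and $\mathcal{S}\subset\mathfrak{T}_1$ is the compact set of quantum states (positive semidefinite matrices of trace $1$). $\mathbf{a}\odot\mathbf{b}=\frac12(\mathbf{ab}+\mathbf{ba})$. Let $\{\mathbf{e}^\mu\}_{\mu=0}^{n^2-1}$ be a basis of $\mathfrak{O}$ orthonormal for the trace inner product with $\mathbf{e}^0=\mathbb{I}/\sqrt n$, and $\mathbf{e}_\mu$ the dual basis (the same matrices). Points of $\mathfrak{T}_1$ are written $\xi=\frac1{\sqrt n}\mathbf{e}_0+x^l\mathbf{e}_l$, with summed Latin indices running over $1,\dots,n^2-1$,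 so $(x^k)$ are global coordinates on $\mathfrak{T}_1$. LaSalle function: let $\Gamma$ be a complete smooth vector field on $\mathfrak{T}_1$ whose flow maps $\mathcal{S}$ into itself for all times $\tau\ge0$ (GKLS vector fields have this property, since $e^{\tau\mathbf{L}}$ is completely positive and trace preserving for $\tau\ge0$). A function $F:\mathfrak{T}_1\to\mathbb{R}$ is a LaSalle function for $\Gamma$ if $F$ is smooth, $F\ge0$ on $\mathcal{S}$, and the Lie derivative satisfies $\mathcal{L}_\Gamma F\le0$ at every point of $\mathcal{S}$. *)

theory Defs
  imports "HOL-Analysis.Analysis"
begin

type_synonym 'n cmat = "complex^'n^'n"

text \<open>
  The Hilbert space is \<open>complex^'n\<close> with \<open>n = CARD('n)\<close>; operators are matrices over it.  Observables
  and their trace-duals are both represented by self-adjoint matrices.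
\<close>

definition self_adjoint :: "'n::finite cmat \<Rightarrow> bool"
  where "self_adjoint A \<longleftrightarrow> (\<forall>i j. A $ i $ j = cnj (A $ j $ i))"

definition jordan_prod :: "'n::finite cmat \<Rightarrow> 'n cmat \<Rightarrow> 'n cmat"  (infixl "\<odot>" 70)
  where "a \<odot> b = (1/2) *\<^sub>R (a ** b + b ** a)"

text \<open>
  On self-adjoint \<open>A\<close> the quadratic form below is real, so taking \<open>Re\<close> loses nothing.
\<close>

definition psd :: "'n::finite cmat \<Rightarrow> bool"
  where "psd A \<longleftrightarrow> self_adjoint A \<and> (\<forall>x. 0 \<le> Re (\<Sum>i\<in>UNIV. cnj (x $ i) * (A *v x) $ i))"

definition T1 :: "'n::finite cmat set"
  where "T1 = {\<xi>. self_adjoint \<xi> \<and> trace \<xi> = 1}"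

text \<open>\<open>T0\<close> is the common tangent space of the affine space \<open>T1\<close> at all of its points.\<close>

definition T0 :: "'n::finite cmat set"
  where "T0 = {u. self_adjoint u \<and> trace u = 0}"

definition states :: "'n::finite cmat set"
  where "states = {\<rho>. psd \<rho> \<and> trace \<rho> = 1}"

text \<open>
  Functions and vector fields on \<open>T1\<close> are represented by functions on all matrices, of which only
  the restriction to \<open>T1\<close> matters.  The derivative within \<open>T1\<close> is determined exactly on the tangent
  directions \<open>T0\<close>, so \<open>Ck_on_T1 k\<close> says that all iterated partial derivatives up to order \<open>k\<close> in
  affine coordinates of \<open>T1\<close> exist and are continuous.
\<close>

primrec Ck_on_T1 :: "nat \<Rightarrow> ('n::finite cmat \<Rightarrow> 'b::real_normed_vector) \<Rightarrow> bool"
  where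
    "Ck_on_T1 0 f \<longleftrightarrow> continuous_on T1 f"
  | "Ck_on_T1 (Suc k) f \<longleftrightarrow>
       (\<exists>f'. (\<forall>\<xi>\<in>T1. (f has_derivative f' \<xi>) (at \<xi> within T1)) \<and>
             (\<forall>u\<in>T0. Ck_on_T1 k (\<lambda>\<xi>. f' \<xi> u)))"

definition smooth_on_T1 :: "('n::finite cmat \<Rightarrow> 'b::real_normed_vector) \<Rightarrow> bool"
  where "smooth_on_T1 f \<longleftrightarrow> (\<forall>k. Ck_on_T1 k f)"

definition smooth_vector_field :: "('n::finite cmat \<Rightarrow> 'n cmat) \<Rightarrow> bool"
  where "smooth_vector_field \<Gamma> \<longleftrightarrow> smooth_on_T1 \<Gamma> \<and> (\<forall>\<xi>\<in>T1. \<Gamma> \<xi> \<in> T0)"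

text \<open>
  \<open>global_flow \<Gamma> \<phi>\<close>: the curve \<open>t \<mapsto> \<phi> t \<xi>\<close> is an integral curve of \<open>\<Gamma>\<close> in \<open>T1\<close>, defined for all
  real times and starting at \<open>\<xi>\<close>.  For a smooth field such a \<open>\<phi>\<close> is unique on \<open>T1\<close>, and the field is
  complete iff it exists.
\<close>

definition global_flow :: "('n::finite cmat \<Rightarrow> 'n cmat) \<Rightarrow> (real \<Rightarrow> 'n cmat \<Rightarrow> 'n cmat) \<Rightarrow> bool"
  where "global_flow \<Gamma> \<phi> \<longleftrightarrow>
    (\<forall>\<xi>\<in>T1. \<phi> 0 \<xi> = \<xi> \<and>
       (\<forall>t. \<phi> t \<xi> \<in> T1 \<and> ((\<lambda>s. \<phi> s \<xi>) has_vector_derivative \<Gamma> (\<phi> t \<xi>)) (at t)))"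

definition complete_vector_field :: "('n::finite cmat \<Rightarrow> 'n cmat) \<Rightarrow> bool"
  where "complete_vector_field \<Gamma> \<longleftrightarrow> (\<exists>\<phi>. global_flow \<Gamma> \<phi>)"

definition preserves_states :: "('n::finite cmat \<Rightarrow> 'n cmat) \<Rightarrow> bool"
  where "preserves_states \<Gamma> \<longleftrightarrow> (\<forall>\<phi>. global_flow \<Gamma> \<phi> \<longrightarrow> (\<forall>\<tau>\<ge>0. \<phi> \<tau> ` states \<subseteq> states))"

text \<open>
  The derivative of \<open>F\<close> at \<open>\<xi>\<close> in the direction \<open>\<Gamma> \<xi>\<close>; the line through \<open>\<xi>\<close> stays in \<open>T1\<close> because
  \<open>\<Gamma> \<xi> \<in> T0\<close>.
\<close>

definition lie_derivative :: "('n::finite cmat \<Rightarrow> 'n cmat) \<Rightarrow> ('n cmat \<Rightarrow> real) \<Rightarrow> 'n cmat \<Rightarrow> real"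
  where "lie_derivative \<Gamma> F \<xi> = deriv (\<lambda>t. F (\<xi> + t *\<^sub>R \<Gamma> \<xi>)) 0"

text \<open>
  LaSalle functions are only considered for complete smooth fields whose flow preserves the states
  in non-negative time; these requirements on the field are part of the predicate.
\<close>

definition LaSalle_function :: "('n::finite cmat \<Rightarrow> 'n cmat) \<Rightarrow> ('n cmat \<Rightarrow> real) \<Rightarrow> bool"
  where "LaSalle_function \<Gamma> F \<longleftrightarrow>
    smooth_vector_field \<Gamma> \<and> complete_vector_field \<Gamma> \<and> preserves_states \<Gamma> \<and>
    smooth_on_T1 F \<and>
    (\<forall>\<rho>\<in>states. 0 \<le> F \<rho>) \<and>
    (\<forall>\<rho>\<in>states. lie_derivative \<Gamma> F \<rho> \<le> 0)"

definition observable_basis :: "(nat \<Rightarrow> 'n::finite cmat) \<Rightarrow> bool"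
  where "observable_basis e \<longleftrightarrow>
    (\<forall>\<mu> < CARD('n)^2. self_adjoint (e \<mu>)) \<and>
    span (e ` {..<CARD('n)^2}) = {A. self_adjoint A} \<and>
    (\<forall>\<mu> < CARD('n)^2. \<forall>\<nu> < CARD('n)^2. trace (e \<mu> ** e \<nu>) = (if \<mu> = \<nu> then 1 else 0)) \<and>
    e 0 = (1 / sqrt CARD('n)) *\<^sub>R mat 1"

definition gaussian_generator :: "'n::finite cmat \<Rightarrow> 'n cmat \<Rightarrow> 'n cmat"
  where "gaussian_generator v \<xi> = - ((v ** v) \<odot> \<xi>) + v ** \<xi> ** v"

text \<open>
  In the coordinates \<open>\<xi> = e 0 / sqrt n + (\<Sum>k. x\<^sub>k *\<^sub>R e k)\<close> of \<open>T1\<close> the coordinate vector field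
  \<open>\<partial>/\<partial>x\<^sub>k\<close> is the constant tangent vector \<open>e k\<close>.  The traces are real for self-adjoint \<open>v\<close>, \<open>\<xi>\<close>, \<open>e k\<close>.
\<close>

definition gaussian_field :: "(nat \<Rightarrow> 'n::finite cmat) \<Rightarrow> 'n cmat \<Rightarrow> 'n cmat \<Rightarrow> 'n cmat"
  where "gaussian_field e v \<xi> =
    (\<Sum>k = 1..CARD('n)^2 - 1.
       (Re (trace (v ** \<xi> ** v ** e k)) - Re (trace (((v ** v) \<odot> \<xi>) ** e k))) *\<^sub>R e k)"

lemma matrix_scaleR_left: "(c *\<^sub>R A) ** B = c *\<^sub>R (A ** B)" for A B :: "'n::finite cmat"
  by (simp add: vec_eq_iff matrix_matrix_mult_def scaleR_sum_right)

lemma matrix_scaleR_right: "A ** (c *\<^sub>R B) = c *\<^sub>R (A ** B)" for A B :: "'n::finite cmat"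
  by (simp add: vec_eq_iff matrix_matrix_mult_def scaleR_sum_right)

lemma matrix_add_left: "(A + B) ** C = A ** C + B ** C" for A B C :: "'n::finite cmat"
  by (simp add: vec_eq_iff matrix_matrix_mult_def sum.distrib distrib_right)

lemma trace_scaleR: "trace (c *\<^sub>R A) = c *\<^sub>R trace A" for A :: "'n::finite cmat"
  by (simp add: trace_def scaleR_sum_right)

lemma self_adjoint_gaussian_generator:
  assumes "self_adjoint v" "self_adjoint \<xi>"
  shows "self_adjoint (gaussian_generator v \<xi>)"
proof -
  define ad where "ad A = (\<chi> i j. cnj (A $ j $ i))" for A :: "'a cmat"
  have sa: "self_adjoint A \<longleftrightarrow> ad A = A" for A
    unfolding self_adjoint_def ad_def vec_eq_iff by (simp add: eq_commute)
  have mult: "ad (A ** B) = ad B ** ad A" for A B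
    by (simp add: ad_def vec_eq_iff matrix_matrix_mult_def mult.commute)
  have add: "ad (A + B) = ad A + ad B" and uminus: "ad (- A) = - ad A"
    and diff: "ad (A - B) = ad A - ad B" and scale: "ad (c *\<^sub>R A) = c *\<^sub>R ad A" for A B c
    by (simp_all add: ad_def vec_eq_iff)
  show ?thesis
    using assms unfolding sa gaussian_generator_def jordan_prod_def
    by (simp add: mult add uminus diff scale matrix_mul_assoc add.commute)
qed

lemma trace_gaussian_generator: "trace (gaussian_generator v \<xi>) = 0"
proof -
  have "trace (v ** \<xi> ** v) = trace (v ** v ** \<xi>)"
    by (subst trace_mul_sym) (simp add: matrix_mul_assoc)
  moreover have "trace (\<xi> ** (v ** v)) = trace (v ** v ** \<xi>)"
    by (rule trace_mul_sym)
  moreover have "trace (- A) = - trace A" for A :: "'a cmat"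
    by (simp add: trace_def sum_negf)
  ultimately show ?thesis
    by (simp add: gaussian_generator_def jordan_prod_def trace_add trace_sub trace_scaleR
        del: add_uminus_conv_diff uminus_add_conv_diff)
qed

lemma observable_basis_expansion:
  fixes e :: "nat \<Rightarrow> 'n::finite cmat"
  assumes "observable_basis e" "self_adjoint A"
  shows "A = (\<Sum>\<mu><CARD('n)^2. Re (trace (A ** e \<mu>)) *\<^sub>R e \<mu>)"
proof -
  let ?g = "\<lambda>A. \<Sum>\<mu><CARD('n)^2. Re (trace (A ** e \<mu>)) *\<^sub>R e \<mu>"
  have 1: "linear (\<lambda>A::'n cmat. A)"
    by (rule linear_ident)
  have 2: "linear ?g"
    by (rule linearI)
      (simp_all add: matrix_add_left trace_add scaleR_add_left sum.distrib
        matrix_scaleR_left trace_scaleR scaleR_sum_right)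
  have 3: "B = ?g B" if "B \<in> e ` {..<CARD('n)^2}" for B
  proof -
    from that obtain \<nu> where \<nu>: "\<nu> < CARD('n)^2" "B = e \<nu>" by auto
    have "?g B = (\<Sum>\<mu><CARD('n)^2. if \<mu> = \<nu> then e \<mu> else 0)"
      using assms(1) \<nu> by (intro sum.cong) (auto simp: observable_basis_def)
    with \<nu> show ?thesis by simp
  qed
  have "A \<in> span (e ` {..<CARD('n)^2})"
    using assms by (simp add: observable_basis_def)
  from linear_eq_on[OF 1 2 this 3] show ?thesis .
qed

text \<open>The coordinate expression is indeed the linear vector field given by the generator.\<close>

lemma gaussian_field_eq_generator:
  assumes "observable_basis e" "self_adjoint v" "\<xi> \<in> T1"
  shows "gaussian_field e v \<xi> = gaussian_generator v \<xi>"
proof -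
  let ?L = "gaussian_generator v \<xi>"
  let ?N = "CARD('a)^2"
  have "e 0 = (1 / sqrt CARD('a)) *\<^sub>R mat 1"
    using assms(1) by (simp add: observable_basis_def)
  hence z: "trace (?L ** e 0) = 0"
    by (simp add: matrix_scaleR_right trace_scaleR trace_gaussian_generator)
  have coeff: "Re (trace (v ** \<xi> ** v ** e k)) - Re (trace (((v ** v) \<odot> \<xi>) ** e k))
      = Re (trace (?L ** e k))" for k
  proof -
    have "?L = v ** \<xi> ** v - (v ** v) \<odot> \<xi>"
      by (simp add: gaussian_generator_def)
    moreover have "(A - B) ** C = A ** C - B ** C" for A B C :: "'a cmat"
      by (simp add: vec_eq_iff matrix_matrix_mult_def sum_subtractf left_diff_distrib)
    ultimately show ?thesis
      by (simp add: trace_sub)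
  qed
  have "0 < ?N"
    by simp
  moreover have "{..<N} = insert 0 {1..N - 1}" if "0 < N" for N :: nat
    using that by auto
  ultimately have sets: "{..<?N} = insert 0 {1..?N - 1}"
    by blast
  have "self_adjoint ?L"
    using assms by (simp add: T1_def self_adjoint_gaussian_generator)
  from observable_basis_expansion[OF assms(1) this]
  have "?L = (\<Sum>k = 1..?N - 1. Re (trace (?L ** e k)) *\<^sub>R e k)"
    unfolding sets by (simp add: z)
  thus ?thesis
    by (simp add: gaussian_field_def coeff)
qed

end

theory Submission
  imports Defs
begin

text \<open>
  On self-adjoint matrices the trace form is the real inner product of the matrix space, so \<open>F\<close> is
  half the squared norm, and \<open>\<xi> \<bullet> L(\<xi>) = - \<parallel>v \<xi> - \<xi> v\<parallel>\<^sup>2 / 2 \<le> 0\<close>.  The same inequality shows that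
  integral curves are unique forwards in time.  Left multiplication by \<open>v\<^sup>2\<close>, right multiplication by
  \<open>v\<^sup>2\<close> and \<open>\<xi> \<mapsto> v \<xi> v\<close> commute, so the flow is
  \<open>\<xi> \<mapsto> W\<^sub>t (\<Sum>k. t\<^sup>k / k! v\<^sup>k \<xi> v\<^sup>k) W\<^sub>t\<close> with \<open>W\<^sub>t = exp (- t v\<^sup>2 / 2)\<close>; for \<open>t \<ge> 0\<close> this is visibly
  positive semidefinite if \<open>\<xi>\<close> is.
\<close>

section \<open>Exponentials of linear operators\<close>

text \<open>The vector \<open>exp (t A) x\<close>, given as a series in the space of
  \<open>x\<close> itself. The operator \<open>A\<close> is a bare function; its linearity is a
  hypothesis of the individual lemmas.\<close>

definition exp_flow :: "('a::euclidean_space \<Rightarrow> 'a) \<Rightarrow> real \<Rightarrow> 'a \<Rightarrow> 'a"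
  where "exp_flow A t x = (\<Sum>k. (t ^ k / fact k) *\<^sub>R (A ^^ k) x)"

lemma norm_funpow_le:
  fixes A :: "'a::real_normed_vector \<Rightarrow> 'a"
  assumes "\<And>x. norm (A x) \<le> K * norm x" "0 \<le> K"
  shows "norm ((A ^^ k) x) \<le> K ^ k * norm x"
proof (induction k)
  case (Suc k)
  have "norm ((A ^^ Suc k) x) \<le> K * norm ((A ^^ k) x)"
    using assms(1) by simp
  also have "\<dots> \<le> K * (K ^ k * norm x)"
    using Suc assms(2) by (rule mult_left_mono)
  finally show ?case by (simp add: mult.assoc)
qed simp

text \<open>With \<open>K\<close> an operator bound for \<open>A\<close>, the series is dominated by
  the scalar exponential series of \<open>\<bar>t\<bar> * K\<close>, scaled by
  \<open>norm x\<close>.\<close>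

lemma summable_exp_flow:
  fixes A :: "'a::euclidean_space \<Rightarrow> 'a"
  assumes "linear A"
  shows "summable (\<lambda>k. (t ^ k / fact k) *\<^sub>R (A ^^ k) x)"
proof -
  obtain K where K: "K > 0" "\<And>x. norm (A x) \<le> K * norm x"
    using linear_bounded_pos[OF assms] by metis
  have "summable (\<lambda>k. inverse (fact k) * (\<bar>t\<bar> * K) ^ k * norm x)"
    by (intro summable_mult2 summable_exp)
  moreover have "norm ((t ^ k / fact k) *\<^sub>R (A ^^ k) x) \<le> inverse (fact k) * (\<bar>t\<bar> * K) ^ k * norm x" for k
  proof -
    have "\<bar>t\<bar> ^ k / fact k * norm ((A ^^ k) x) \<le> \<bar>t\<bar> ^ k / fact k * (K ^ k * norm x)"
      using K by (intro mult_left_mono norm_funpow_le) auto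
    thus ?thesis
      by (simp add: power_abs power_mult_distrib field_simps)
  qed
  ultimately show ?thesis
    by (rule summable_comparison_test')
qed

lemma exp_flow_0: "exp_flow A 0 x = x"
proof -
  \<comment> \<open>Since \<open>0 ^ 0 = 1\<close>, exactly the term with \<open>k = 0\<close>
    survives.\<close>
  have "(\<lambda>k. (0 ^ k / fact k) *\<^sub>R (A ^^ k) x) = (\<lambda>k. if k = 0 then x else 0)"
    by auto
  thus ?thesis
    using sums_single[of 0 "\<lambda>_. x"] by (simp add: exp_flow_def sums_iff)
qed

lemma linear_exp_flow:
  fixes A :: "'a::euclidean_space \<Rightarrow> 'a"
  assumes "linear A"
  shows "A (exp_flow A t x) = exp_flow A t (A x)"
proof -
  have "A (exp_flow A t x) = (\<Sum>k. A ((t ^ k / fact k) *\<^sub>R (A ^^ k) x))"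
    unfolding exp_flow_def
    by (rule bounded_linear.suminf)
      (use assms in \<open>simp_all add: linear_conv_bounded_linear summable_exp_flow\<close>)
  also have "\<dots> = exp_flow A t (A x)"
    by (simp add: exp_flow_def linear_scale[OF assms] funpow_swap1)
  finally show ?thesis .
qed

text \<open>Pairing with a fixed vector turns the flow into a real power series in \<open>t\<close>,
  to which termwise differentiation applies.\<close>

lemma exp_flow_inner:
  fixes A :: "'a::euclidean_space \<Rightarrow> 'a"
  assumes "linear A"
  shows "exp_flow A t x \<bullet> b = (\<Sum>k. ((A ^^ k) x \<bullet> b / fact k) * t ^ k)"
    and "summable (\<lambda>k. ((A ^^ k) x \<bullet> b / fact k) * t ^ k)"
  using bounded_linear.suminf[OF bounded_linear_inner_left[of b] summable_exp_flow[OF assms, of t x]]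
    bounded_linear.summable[OF bounded_linear_inner_left[of b] summable_exp_flow[OF assms, of t x]]
  by (simp_all add: exp_flow_def field_simps)

lemma exp_flow_has_vector_derivative:
  fixes A :: "'a::euclidean_space \<Rightarrow> 'a"
  assumes "linear A"
  shows "((\<lambda>t. exp_flow A t x) has_vector_derivative A (exp_flow A t x)) (at t)"
proof -
  have "((\<lambda>t. exp_flow A t x \<bullet> b) has_vector_derivative A (exp_flow A t x) \<bullet> b) (at t)" for b
  proof -
    let ?c = "\<lambda>k. (A ^^ k) x \<bullet> b / fact k"
    have "((\<lambda>t. \<Sum>k. ?c k * t ^ k) has_field_derivative (\<Sum>k. diffs ?c k * t ^ k)) (at t)"
      by (rule termdiffs_strong_converges_everywhere) (rule exp_flow_inner[OF assms])
    \<comment> \<open>The factor \<open>Suc k\<close> produced by \<open>diffs\<close> reduces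
      \<open>fact (Suc k)\<close> to \<open>fact k\<close>, and the additional application of
      \<open>A\<close> is moved onto \<open>x\<close>. The differentiated series is therefore the
      flow started at \<open>A x\<close>.\<close>
    moreover have "diffs ?c k = (A ^^ k) (A x) \<bullet> b / fact k" for k
      by (simp add: diffs_def funpow_swap1 del: of_nat_Suc)
    ultimately show ?thesis
      by (simp add: linear_exp_flow[OF assms] exp_flow_inner[OF assms]
          has_real_derivative_iff_has_vector_derivative)
  qed
  thus ?thesis
    unfolding has_vector_derivative_def
    by (subst has_derivative_componentwise_within) simp
qed

text \<open>All partial sums lie in \<open>C\<close>, hence so does their limit. Scaling is demanded
  only for the coefficients \<open>t ^ k / fact k\<close>, so that the lemma covers subspaces for
  every \<open>t\<close> and convex cones for non-negative \<open>t\<close>.\<close>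

lemma exp_flow_in_closed:
  fixes A :: "'a::euclidean_space \<Rightarrow> 'a"
  assumes "linear A" "closed C" "x \<in> C" "0 \<in> C"
    and add: "\<And>x y. x \<in> C \<Longrightarrow> y \<in> C \<Longrightarrow> x + y \<in> C"
    and inv: "\<And>x. x \<in> C \<Longrightarrow> A x \<in> C"
    and scale: "\<And>k x. x \<in> C \<Longrightarrow> (t ^ k / fact k) *\<^sub>R x \<in> C"
  shows "exp_flow A t x \<in> C"
proof -
  have pow: "(A ^^ k) x \<in> C" for k
    by (induction k) (auto simp: assms inv)
  have "(\<Sum>k<n. (t ^ k / fact k) *\<^sub>R (A ^^ k) x) \<in> C" for n
    by (induction n) (auto simp: assms pow intro!: add scale)
  moreover have "(\<lambda>n. \<Sum>k<n. (t ^ k / fact k) *\<^sub>R (A ^^ k) x) \<longlonglongrightarrow> exp_flow A t x"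
    unfolding exp_flow_def by (intro summable_LIMSEQ summable_exp_flow assms)
  ultimately show ?thesis
    by (rule closed_sequentially[OF \<open>closed C\<close>])
qed

lemma exp_flow_in_subspace:
  fixes A :: "'a::euclidean_space \<Rightarrow> 'a"
  assumes "linear A" "subspace C" "x \<in> C" "\<And>x. x \<in> C \<Longrightarrow> A x \<in> C"
  shows "exp_flow A t x \<in> C"
  using assms
  by (intro exp_flow_in_closed) (auto simp: closed_subspace subspace_0 subspace_add subspace_scale)

text \<open>The squared distance of the two curves has non-positive derivative and starts at zero,
  so it stays zero for non-negative times.\<close>

lemma dissipative_integral_curves_eq:
  fixes x y :: "real \<Rightarrow> 'a::real_inner"
  assumes x: "\<And>s. (x has_vector_derivative x' s) (at s)"
    and y: "\<And>s. (y has_vector_derivative y' s) (at s)"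
    and dissipative: "\<And>s. (x s - y s) \<bullet> (x' s - y' s) \<le> 0"
    and "x 0 = y 0" "0 \<le> t"
  shows "x t = y t"
proof -
  let ?d = "\<lambda>s. x s - y s"
  have "((\<lambda>s. ?d s \<bullet> ?d s) has_vector_derivative ?d s \<bullet> (x' s - y' s) + (x' s - y' s) \<bullet> ?d s) (at s)" for s
    using bounded_bilinear.has_vector_derivative[OF bounded_bilinear_inner
        has_vector_derivative_diff[OF x y] has_vector_derivative_diff[OF x y]] .
  moreover have "?d s \<bullet> (x' s - y' s) + (x' s - y' s) \<bullet> ?d s \<le> 0" for s
    using dissipative[of s] by (simp add: inner_commute)
  ultimately have "?d t \<bullet> ?d t \<le> ?d 0 \<bullet> ?d 0"
    unfolding has_real_derivative_iff_has_vector_derivative[symmetric]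
    by (intro DERIV_nonpos_imp_nonincreasing[OF \<open>0 \<le> t\<close>]) blast
  hence "?d t \<bullet> ?d t \<le> 0"
    using \<open>x 0 = y 0\<close> by simp
  thus ?thesis
    by (metis inner_ge_zero inner_eq_zero_iff order_antisym eq_iff_diff_eq_0)
qed

section \<open>Adjoints and the trace form\<close>

definition adjoint_mat :: "'n::finite cmat \<Rightarrow> 'n cmat"
  where "adjoint_mat A = (\<chi> i j. cnj (A $ j $ i))"

lemma self_adjoint_iff: "self_adjoint A \<longleftrightarrow> adjoint_mat A = A"
  unfolding self_adjoint_def adjoint_mat_def vec_eq_iff by (simp add: eq_commute)

lemma adjoint_mat_mult: "adjoint_mat (A ** B) = adjoint_mat B ** adjoint_mat A"
  by (simp add: adjoint_mat_def vec_eq_iff matrix_matrix_mult_def mult.commute)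

lemma adjoint_mat_simps [simp]:
  "adjoint_mat 0 = 0" "adjoint_mat (mat 1) = mat 1"
  "adjoint_mat (A + B) = adjoint_mat A + adjoint_mat B"
  "adjoint_mat (A - B) = adjoint_mat A - adjoint_mat B"
  "adjoint_mat (c *\<^sub>R A) = c *\<^sub>R adjoint_mat A"
  by (auto simp: adjoint_mat_def vec_eq_iff mat_def)

lemma linear_adjoint_mat: "linear adjoint_mat"
  by (rule linearI) simp_all

lemma subspace_self_adjoint: "subspace {A. self_adjoint A}"
  by (auto simp: self_adjoint_iff subspace_def)

lemma inner_complex_cnj: "x \<bullet> y = Re (cnj x * y)" for x y :: complex
  by (simp add: inner_complex_def)

text \<open>The inner product of the matrix space is the real part of the Hilbert-Schmidt product,
  which conjugates its first argument; the adjoint accounts for this. For self-adjoint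
  \<open>A\<close> it disappears.\<close>

lemma Re_trace_mult_eq_inner: "Re (trace (A ** B)) = adjoint_mat A \<bullet> B"
proof -
  have "Re (trace (A ** B)) = (\<Sum>i\<in>UNIV. \<Sum>k\<in>UNIV. Re (A $ i $ k * B $ k $ i))"
    by (simp add: trace_def matrix_matrix_mult_def)
  also have "\<dots> = (\<Sum>k\<in>UNIV. \<Sum>i\<in>UNIV. Re (A $ i $ k * B $ k $ i))"
    by (rule sum.swap)
  also have "\<dots> = adjoint_mat A \<bullet> B"
    by (simp add: inner_vec_def adjoint_mat_def inner_complex_cnj)
  finally show ?thesis .
qed

lemma inner_matrix_vector_mult: "x \<bullet> (A *v y) = (adjoint_mat A *v x) \<bullet> y"
  for A :: "'n::finite cmat"
proof -
  have "x \<bullet> (A *v y) = (\<Sum>i\<in>UNIV. \<Sum>k\<in>UNIV. Re (cnj (x $ i) * (A $ i $ k * y $ k)))"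
    by (simp add: inner_vec_def inner_complex_cnj matrix_vector_mult_def sum_distrib_left
        del: times_complex.sel)
  also have "\<dots> = (\<Sum>k\<in>UNIV. \<Sum>i\<in>UNIV. Re (cnj (x $ i) * (A $ i $ k * y $ k)))"
    by (rule sum.swap)
  also have "\<dots> = (adjoint_mat A *v x) \<bullet> y"
    by (simp add: inner_vec_def inner_complex_cnj matrix_vector_mult_def sum_distrib_left
       sum_distrib_right         adjoint_mat_def mult_ac del: times_complex.sel)
  finally show ?thesis .
qed

section \<open>The closed convex cone of positive semidefinite matrices\<close>

lemma psd_iff: "psd A \<longleftrightarrow> self_adjoint A \<and> (\<forall>x. 0 \<le> x \<bullet> (A *v x))"
  by (simp add: psd_def inner_vec_def inner_complex_cnj)

lemma self_adjoint_sandwich: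
  "self_adjoint B \<Longrightarrow> self_adjoint A \<Longrightarrow> self_adjoint (B ** A ** B)"
  by (simp add: self_adjoint_iff adjoint_mat_mult matrix_mul_assoc)

text \<open>Moving the left factor \<open>B\<close> to the other side of the inner product turns the
  quadratic form of \<open>B ** A ** B\<close> at \<open>x\<close> into that of \<open>A\<close> at
  \<open>B *v x\<close>.\<close>

lemma psd_sandwich: "self_adjoint B \<Longrightarrow> psd A \<Longrightarrow> psd (B ** A ** B)"
  by (simp add: psd_iff self_adjoint_sandwich matrix_vector_mul_assoc[symmetric]
      inner_matrix_vector_mult[of _ B] self_adjoint_iff[of B])

lemma linear_matrix_vector_mult_left: "linear (\<lambda>A::'n::finite cmat. A *v x)"
  by (rule linearI)
    (simp_all add: vec_eq_iff matrix_vector_mult_def sum.distrib distrib_right scaleR_sum_right)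

lemma psd_0: "psd 0"
  using linear_0[OF linear_matrix_vector_mult_left] by (simp add: psd_iff self_adjoint_iff)

lemma psd_add: "psd A \<Longrightarrow> psd B \<Longrightarrow> psd (A + B)"
  by (simp add: psd_iff self_adjoint_iff linear_add[OF linear_matrix_vector_mult_left] inner_add_right)

lemma psd_scaleR: "psd A \<Longrightarrow> 0 \<le> c \<Longrightarrow> psd (c *\<^sub>R A)"
  by (simp add: psd_iff self_adjoint_iff linear_scale[OF linear_matrix_vector_mult_left])

text \<open>The cone is the intersection of a subspace with closed half-spaces, one for each vector
  \<open>x\<close>.\<close>

lemma closed_psd: "closed {A :: 'n::finite cmat. psd A}"
proof -
  have "{A :: 'n cmat. psd A} = {A. self_adjoint A} \<inter> (\<Inter>x. {A. 0 \<le> x \<bullet> (A *v x)})"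
    by (auto simp: psd_iff)
  moreover have "closed {A :: 'n cmat. 0 \<le> x \<bullet> (A *v x)}" for x
    by (intro closed_Collect_le continuous_intros linear_continuous_on
        linear_matrix_vector_mult_left[unfolded linear_conv_bounded_linear])
  moreover have "closed {A :: 'n cmat. self_adjoint A}"
    by (rule closed_subspace[OF subspace_self_adjoint])
  ultimately show ?thesis
    by (simp add: closed_Int closed_INT)
qed

lemma bounded_bilinear_matrix_mult: "bounded_bilinear ((**) :: 'n::finite cmat \<Rightarrow> 'n cmat \<Rightarrow> 'n cmat)"
proof -
  have "bilinear ((**) :: 'n cmat \<Rightarrow> 'n cmat \<Rightarrow> 'n cmat)"
    unfolding bilinear_def
    by (auto intro!: linearI
        simp: matrix_add_left matrix_add_ldistrib matrix_scaleR_left matrix_scaleR_right)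
  thus ?thesis
    by (simp add: bilinear_conv_bounded_bilinear)
qed

lemmas linear_matrix_mult_left =
  bounded_linear.linear[OF bounded_bilinear.bounded_linear_left[OF bounded_bilinear_matrix_mult]]

lemmas linear_matrix_mult_right =
  bounded_linear.linear[OF bounded_bilinear.bounded_linear_right[OF bounded_bilinear_matrix_mult]]

lemmas matrix_diff_left = linear_diff[OF linear_matrix_mult_left]

lemmas matrix_diff_right = linear_diff[OF linear_matrix_mult_right]

lemma bounded_linear_trace: "bounded_linear (trace :: 'n::finite cmat \<Rightarrow> complex)"
  unfolding linear_conv_bounded_linear[symmetric]
  by (rule linearI) (simp_all add: trace_add trace_scaleR)

section \<open>The Gaussian semigroup\<close>

text \<open>The commutator \<open>?C\<close> of two self-adjoint matrices is skew-adjoint, so the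
  trace of its square is minus its squared norm. By cyclicity that trace is also twice the trace of
  \<open>A ** gaussian_generator v A\<close>.\<close>

lemma inner_gaussian_generator_nonpos:
  assumes "self_adjoint v" "self_adjoint A"
  shows "A \<bullet> gaussian_generator v A \<le> 0"
proof -
  let ?C = "v ** A - A ** v"
  have "adjoint_mat ?C = - ?C"
    using assms by (simp add: self_adjoint_iff adjoint_mat_mult)
  hence "- (?C \<bullet> ?C) = Re (trace (?C ** ?C))"
    by (simp only: Re_trace_mult_eq_inner inner_minus_left)
  also have "\<dots> = 2 * Re (trace (A ** gaussian_generator v A))"
  proof -
    have L: "gaussian_generator v A = v ** A ** v - (1/2) *\<^sub>R (v ** v ** A + A ** (v ** v))"
      by (simp add: gaussian_generator_def jordan_prod_def)
    \<comment> \<open>Cyclic rotation brings each word with two factors \<open>v\<close> and two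
      factors \<open>A\<close> to one of two normal forms, \<open>v ** v ** A ** A\<close> or
      \<open>A ** v ** A ** v\<close>.\<close>
    have 1: "trace (v ** A ** A ** v) = trace (v ** v ** A ** A)"
      using trace_mul_sym[of "v ** A ** A" v] by (simp add: matrix_mul_assoc)
    have 2: "trace (A ** v ** v ** A) = trace (v ** v ** A ** A)"
      using trace_mul_sym[of A "v ** v ** A"] by (simp add: matrix_mul_assoc)
    have 3: "trace (A ** A ** v ** v) = trace (v ** v ** A ** A)"
      using trace_mul_sym[of "A ** A" "v ** v"] by (simp add: matrix_mul_assoc)
    have 4: "trace (v ** A ** v ** A) = trace (A ** v ** A ** v)"
      using trace_mul_sym[of v "A ** v ** A"] by (simp add: matrix_mul_assoc)
    show ?thesis
      unfolding L
      by (simp add: matrix_diff_left matrix_diff_right matrix_add_ldistrib matrix_scaleR_right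
          matrix_mul_assoc trace_add trace_sub trace_scaleR 1 2 3 4)
  qed
  also have "\<dots> = 2 * (A \<bullet> gaussian_generator v A)"
    using assms by (simp add: Re_trace_mult_eq_inner self_adjoint_iff)
  finally show ?thesis
    using inner_ge_zero[of ?C] by linarith
qed

section \<open>The explicit flow of the Gaussian generator\<close>

text \<open>The matrix exponential of \<open>- t v\<^sup>2 / 2\<close>, obtained by letting left
  multiplication by \<open>- v\<^sup>2 / 2\<close> flow from the identity, so that the results on
  \<open>exp_flow\<close> apply to it.\<close>

definition gaussian_damping :: "'n::finite cmat \<Rightarrow> real \<Rightarrow> 'n cmat"
  where "gaussian_damping v t = exp_flow (\<lambda>X. (- 1/2) *\<^sub>R (v ** v ** X)) t (mat 1)"

definition gaussian_flow :: "'n::finite cmat \<Rightarrow> real \<Rightarrow> 'n cmat \<Rightarrow> 'n cmat"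
  where "gaussian_flow v t \<xi> =
    gaussian_damping v t ** exp_flow (\<lambda>X. v ** X ** v) t \<xi> ** gaussian_damping v t"

lemma linear_damping: "linear (\<lambda>X::'n::finite cmat. (- 1/2) *\<^sub>R (v ** v ** X))"
  by (intro linear_compose_scale_right linear_matrix_mult_right)

lemma linear_sandwich: "linear (\<lambda>X::'n::finite cmat. v ** X ** v)"
  using linear_compose[OF linear_matrix_mult_right linear_matrix_mult_left]
  by (simp add: o_def)

text \<open>Both facts are invariance of a subspace that contains the identity and is mapped into
  itself by left multiplication by \<open>v ** v\<close>. For the first it is the commutant of
  \<open>v\<close>.\<close>

lemma gaussian_damping_commute: "v ** gaussian_damping v t = gaussian_damping v t ** v"
  and self_adjoint_gaussian_damping: "self_adjoint v \<Longrightarrow> self_adjoint (gaussian_damping v t)"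
proof -
  let ?C = "{X. v ** X = X ** v}"
  have "subspace ?C"
    by (auto simp: subspace_def matrix_add_left matrix_add_ldistrib matrix_scaleR_left
        matrix_scaleR_right linear_0[OF linear_matrix_mult_left] linear_0[OF linear_matrix_mult_right])
  have commute: "v ** (v ** v ** X) = v ** v ** X ** v"
    and commute': "v ** v ** X = X ** (v ** v)" if "v ** X = X ** v" for X
  proof -
    have "v ** (v ** v ** X) = v ** v ** (v ** X)"
      by (simp add: matrix_mul_assoc)
    also have "\<dots> = v ** v ** X ** v"
      by (subst that) (simp add: matrix_mul_assoc)
    finally show "v ** (v ** v ** X) = v ** v ** X ** v" .
    have "v ** v ** X = v ** (v ** X)"
      by (simp add: matrix_mul_assoc)
    also have "\<dots> = v ** X ** v"
      by (subst that) (simp add: matrix_mul_assoc)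
    also have "\<dots> = X ** (v ** v)"
      by (subst that) (simp add: matrix_mul_assoc)
    finally show "v ** v ** X = X ** (v ** v)" .
  qed
  have "(- 1/2) *\<^sub>R (v ** v ** X) \<in> ?C" if "X \<in> ?C" for X
    using that commute by (intro subspace_scale \<open>subspace ?C\<close>) simp
  with \<open>subspace ?C\<close> show "v ** gaussian_damping v t = gaussian_damping v t ** v"
    using exp_flow_in_subspace[OF linear_damping[of v], of ?C "mat 1" t]
    by (simp add: gaussian_damping_def)
  assume v: "self_adjoint v"
  \<comment> \<open>For self-adjoint \<open>X\<close> the adjoint of \<open>v ** v ** X\<close> is
    \<open>X ** (v ** v)\<close>. Self-adjointness is therefore propagated inside the commutant,
    where the two agree.\<close>
  have "subspace (?C \<inter> {X. self_adjoint X})"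
    by (intro subspace_inter \<open>subspace ?C\<close> subspace_self_adjoint)
  moreover have "(- 1/2) *\<^sub>R (v ** v ** X) \<in> ?C \<inter> {X. self_adjoint X}"
    if "X \<in> ?C \<inter> {X. self_adjoint X}" for X
    using that v commute commute'
    by (intro subspace_scale \<open>subspace (?C \<inter> {X. self_adjoint X})\<close>)
      (simp add: self_adjoint_iff adjoint_mat_mult)
  ultimately show "self_adjoint (gaussian_damping v t)"
    using exp_flow_in_subspace[OF linear_damping[of v], of "?C \<inter> {X. self_adjoint X}" "mat 1" t]
    by (simp add: gaussian_damping_def self_adjoint_iff)
qed

lemma gaussian_flow_0: "gaussian_flow v 0 \<xi> = \<xi>"
  by (simp add: gaussian_flow_def gaussian_damping_def exp_flow_0)

text \<open>In the product rule, differentiating the two damping factors gives the two halves of the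
  Jordan product with \<open>v ** v\<close>, and differentiating the middle factor gives the
  sandwich term.\<close>

lemma gaussian_flow_has_vector_derivative:
  "((\<lambda>t. gaussian_flow v t \<xi>) has_vector_derivative gaussian_generator v (gaussian_flow v t \<xi>)) (at t)"
proof -
  let ?W = "\<lambda>t. gaussian_damping v t"
  let ?S = "\<lambda>t. exp_flow (\<lambda>X. v ** X ** v) t \<xi>"
  let ?W' = "(- 1/2) *\<^sub>R (v ** v ** ?W t)"
  note has_product = bounded_bilinear.has_vector_derivative[OF bounded_bilinear_matrix_mult]
  have W: "(?W has_vector_derivative ?W') (at t)"
    unfolding gaussian_damping_def by (rule exp_flow_has_vector_derivative[OF linear_damping])
  have S: "(?S has_vector_derivative (v ** ?S t ** v)) (at t)"
    by (rule exp_flow_has_vector_derivative[OF linear_sandwich])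
  have "((\<lambda>t. gaussian_flow v t \<xi>) has_vector_derivative
      ?W t ** ?S t ** ?W' + (?W t ** (v ** ?S t ** v) + ?W' ** ?S t) ** ?W t) (at t)"
    unfolding gaussian_flow_def by (rule has_product[OF has_product[OF W S] W])
  \<comment> \<open>Commutation is used at both ends: left-associated words expose
    \<open>v ** ?W t\<close> at the left end, right-associated words expose it at the right
    end.\<close>
  moreover have "?W t ** (v ** ?S t ** v) ** ?W t = v ** gaussian_flow v t \<xi> ** v"
    by (simp add: gaussian_flow_def matrix_mul_assoc gaussian_damping_commute)
      (simp add: gaussian_damping_commute flip: matrix_mul_assoc)
  moreover have "v ** v ** ?W t = ?W t ** v ** v"
    by (simp add: gaussian_damping_commute flip: matrix_mul_assoc)
      (simp add: gaussian_damping_commute matrix_mul_assoc)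
  hence "?W t ** ?S t ** ?W' = (- 1/2) *\<^sub>R (gaussian_flow v t \<xi> ** (v ** v))"
    by (simp only: gaussian_flow_def matrix_scaleR_right matrix_mul_assoc)
  moreover have "?W' ** ?S t ** ?W t = (- 1/2) *\<^sub>R (v ** v ** gaussian_flow v t \<xi>)"
    by (simp only: gaussian_flow_def matrix_scaleR_left matrix_mul_assoc)
  ultimately show ?thesis
    by (simp add: gaussian_generator_def jordan_prod_def matrix_add_left scaleR_add_right algebra_simps)
qed

lemma self_adjoint_gaussian_flow:
  assumes "self_adjoint v" "self_adjoint \<xi>"
  shows "self_adjoint (gaussian_flow v t \<xi>)"
proof -
  have "exp_flow (\<lambda>X. v ** X ** v) t \<xi> \<in> {A. self_adjoint A}"
    using assms
    by (intro exp_flow_in_subspace linear_sandwich subspace_self_adjoint)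
      (auto intro: self_adjoint_sandwich)
  thus ?thesis
    using assms
    by (simp add: gaussian_flow_def self_adjoint_sandwich self_adjoint_gaussian_damping)
qed

text \<open>Sandwiching by \<open>v\<close> preserves the closed cone, and \<open>0 \<le> t\<close>
  makes the coefficients of the series non-negative. Sandwiching by the self-adjoint damping matrix
  then stays in the cone.\<close>

lemma psd_gaussian_flow:
  assumes "self_adjoint v" "psd \<xi>" "0 \<le> t"
  shows "psd (gaussian_flow v t \<xi>)"
proof -
  have "exp_flow (\<lambda>X. v ** X ** v) t \<xi> \<in> {A. psd A}"
    using assms
    by (intro exp_flow_in_closed linear_sandwich closed_psd)
      (auto intro: psd_0 psd_add psd_scaleR psd_sandwich)
  thus ?thesis
    using assms by (simp add: gaussian_flow_def psd_sandwich self_adjoint_gaussian_damping)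
qed

text \<open>The derivative of the trace along the flow is the trace of a value of the generator,
  which is zero.\<close>

lemma trace_gaussian_flow: "trace (gaussian_flow v t \<xi>) = trace \<xi>"
proof -
  have "((\<lambda>s. trace (gaussian_flow v s \<xi>)) has_vector_derivative 0) (at s)" for s
    using bounded_linear.has_vector_derivative[OF bounded_linear_trace
        gaussian_flow_has_vector_derivative[of v \<xi> s]]
    by (simp add: trace_gaussian_generator)
  then obtain c where "\<And>s. trace (gaussian_flow v s \<xi>) = c"
    using has_vector_derivative_zero_constant[of UNIV "\<lambda>s. trace (gaussian_flow v s \<xi>)"]
    by auto
  from this[of t] this[of 0] show ?thesis
    by (simp add: gaussian_flow_0)
qed

lemma gaussian_flow_in_T1: "self_adjoint v \<Longrightarrow> \<xi> \<in> T1 \<Longrightarrow> gaussian_flow v t \<xi> \<in> T1"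
  by (simp add: T1_def self_adjoint_gaussian_flow trace_gaussian_flow)

lemma gaussian_flow_in_states:
  "self_adjoint v \<Longrightarrow> \<rho> \<in> states \<Longrightarrow> 0 \<le> t \<Longrightarrow> gaussian_flow v t \<rho> \<in> states"
  by (simp add: states_def psd_gaussian_flow trace_gaussian_flow)

lemma states_subset_T1: "states \<subseteq> T1"
  by (auto simp: states_def T1_def psd_def)

lemma global_flow_gaussian_flow:
  assumes "self_adjoint v" "observable_basis e"
  shows "global_flow (gaussian_field e v) (gaussian_flow v)"
  using assms
  by (simp add: global_flow_def gaussian_flow_0 gaussian_flow_in_T1 gaussian_field_eq_generator
      gaussian_flow_has_vector_derivative)

lemma linear_gaussian_generator: "linear (gaussian_generator v)"
  by (rule linearI)
    (simp_all add: gaussian_generator_def jordan_prod_def matrix_add_left matrix_add_ldistrib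
      matrix_scaleR_left matrix_scaleR_right algebra_simps)

text \<open>Since \<open>preserves_states\<close> speaks of every global flow, any such flow has to
  be identified with the explicit one. By linearity the dissipation inequality applies to the
  difference of two integral curves, which is self-adjoint.\<close>

lemma global_flow_eq_gaussian_flow:
  assumes "self_adjoint v" "observable_basis e"
    and "global_flow (gaussian_field e v) \<phi>" "\<xi> \<in> T1" "0 \<le> t"
  shows "\<phi> t \<xi> = gaussian_flow v t \<xi>"
proof (rule dissipative_integral_curves_eq[OF _ gaussian_flow_has_vector_derivative _ _ \<open>0 \<le> t\<close>])
  have \<phi>: "\<phi> 0 \<xi> = \<xi>" "\<phi> s \<xi> \<in> T1"
    "((\<lambda>s. \<phi> s \<xi>) has_vector_derivative gaussian_field e v (\<phi> s \<xi>)) (at s)" for s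
    using assms unfolding global_flow_def by auto
  show "((\<lambda>s. \<phi> s \<xi>) has_vector_derivative gaussian_generator v (\<phi> s \<xi>)) (at s)" for s
    using \<phi>(3)[of s] assms by (simp add: gaussian_field_eq_generator \<phi>(2))
  show "\<phi> 0 \<xi> = gaussian_flow v 0 \<xi>"
    by (simp add: \<phi>(1) gaussian_flow_0)
  show "(\<phi> s \<xi> - gaussian_flow v s \<xi>) \<bullet>
      (gaussian_generator v (\<phi> s \<xi>) - gaussian_generator v (gaussian_flow v s \<xi>)) \<le> 0" for s
    unfolding linear_diff[OF linear_gaussian_generator, symmetric]
    using \<phi>(2)[of s] gaussian_flow_in_T1[OF assms(1,4), of s] assms(1)
    by (intro inner_gaussian_generator_nonpos) (simp_all add: T1_def self_adjoint_iff)
qed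

section \<open>Smoothness and the Lie derivative\<close>

lemma Ck_on_T1_const: "Ck_on_T1 k (\<lambda>_. c)"
proof (induction k arbitrary: c)
  case (Suc k)
  show ?case
    using Suc[of 0] by (auto intro!: exI[of _ "\<lambda>_ _. 0"])
qed simp

lemma smooth_on_T1_linear:
  fixes f :: "'n::finite cmat \<Rightarrow> 'b::real_normed_vector"
  assumes "linear f"
  shows "smooth_on_T1 f"
proof -
  have f: "bounded_linear f"
    using assms by (simp add: linear_conv_bounded_linear)
  have "Ck_on_T1 k f" for k
  proof (cases k)
    case 0
    thus ?thesis by (simp add: linear_continuous_on[OF f])
  next
    case (Suc m)
    thus ?thesis
      by (auto intro!: exI[of _ "\<lambda>_. f"] bounded_linear_imp_has_derivative[OF f] Ck_on_T1_const)
  qed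
  thus ?thesis by (simp add: smooth_on_T1_def)
qed

text \<open>The derivative in a fixed direction \<open>u\<close> is linear in the base point, so the
  higher orders are those of a linear map.\<close>

lemma smooth_on_T1_bilinear:
  fixes b :: "'n::finite cmat \<Rightarrow> 'n cmat \<Rightarrow> 'b::real_normed_vector"
  assumes "bounded_bilinear b"
  shows "smooth_on_T1 (\<lambda>\<xi>. b \<xi> \<xi>)"
proof -
  interpret bounded_bilinear b by fact
  have "Ck_on_T1 k (\<lambda>\<xi>. b \<xi> \<xi>)" for k
  proof (cases k)
    case 0
    thus ?thesis by (simp add: continuous_on continuous_on_id)
  next
    case (Suc m)
    have "linear (\<lambda>\<xi>. b \<xi> u + b u \<xi>)" for u
      by (intro linear_compose_add bounded_linear.linear bounded_linear_left bounded_linear_right)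
    hence "Ck_on_T1 m (\<lambda>\<xi>. b \<xi> u + b u \<xi>)" for u
      using smooth_on_T1_linear by (auto simp: smooth_on_T1_def)
    moreover have "((\<lambda>\<xi>. b \<xi> \<xi>) has_derivative (\<lambda>u. b \<xi> u + b u \<xi>)) (at \<xi> within T1)" for \<xi>
      by (rule FDERIV) (auto intro: derivative_eq_intros)
    ultimately show ?thesis
      unfolding Suc by (auto intro!: exI[of _ "\<lambda>\<xi> u. b \<xi> u + b u \<xi>"])
  qed
  thus ?thesis by (simp add: smooth_on_T1_def)
qed

section \<open>The purity function and its derivative along the field\<close>

lemma bounded_bilinear_purity:
  "bounded_bilinear (\<lambda>A B::'n::finite cmat. 1/2 * Re (trace (A ** B)))"
proof -
  have "bounded_linear (\<lambda>A::'n cmat. (1/2) *\<^sub>R adjoint_mat A)"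
    using linear_adjoint_mat linear_conv_bounded_linear
    by (intro bounded_linear_const_scaleR) blast
  from bounded_bilinear.comp1[OF bounded_bilinear_inner this]
  have "bounded_bilinear (\<lambda>A B::'n cmat. ((1/2) *\<^sub>R adjoint_mat A) \<bullet> B)" .
  thus ?thesis
    by (simp only: Re_trace_mult_eq_inner inner_scaleR_left)
qed

text \<open>Along the line through \<open>\<xi>\<close> in direction \<open>\<Gamma> \<xi>\<close>
  the function is a quadratic polynomial in \<open>t\<close>, and its derivative at zero is the
  linear coefficient.\<close>

lemma lie_derivative_purity:
  assumes "self_adjoint \<xi>" "self_adjoint (\<Gamma> \<xi>)"
  shows "lie_derivative \<Gamma> (\<lambda>\<xi>. 1/2 * Re (trace (\<xi> ** \<xi>))) \<xi> = \<xi> \<bullet> \<Gamma> \<xi>"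
proof -
  let ?u = "\<Gamma> \<xi>"
  have "1/2 * Re (trace ((\<xi> + t *\<^sub>R ?u) ** (\<xi> + t *\<^sub>R ?u))) =
      1/2 * (\<xi> \<bullet> \<xi>) + t * (\<xi> \<bullet> ?u) + t\<^sup>2 * (1/2 * (?u \<bullet> ?u))" for t
    using assms
    by (simp add: Re_trace_mult_eq_inner self_adjoint_iff inner_add inner_commute
        power2_eq_square algebra_simps)
  moreover have "((\<lambda>t. 1/2 * (\<xi> \<bullet> \<xi>) + t * (\<xi> \<bullet> ?u) + t\<^sup>2 * (1/2 * (?u \<bullet> ?u)))
      has_field_derivative \<xi> \<bullet> ?u) (at 0)"
    by (auto intro!: derivative_eq_intros)
  ultimately show ?thesis
    unfolding lie_derivative_def by (simp only: DERIV_imp_deriv)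
qed

text \<open>Linearity on all matrices is read off the coordinate formula, because the identification
  with the generator is available on \<open>T1\<close> only, which is not a subspace.\<close>

lemma linear_gaussian_field: "linear (gaussian_field e v)"
  unfolding gaussian_field_def linear_conv_bounded_linear
  by (intro bounded_linear_sum bounded_linear_scaleR_const bounded_linear_sub;
      unfold linear_conv_bounded_linear[symmetric]; rule linearI)
    (simp_all add: matrix_add_left matrix_add_ldistrib matrix_scaleR_left matrix_scaleR_right
      jordan_prod_def trace_add trace_scaleR algebra_simps)

lemma gaussian_field_in_T0:
  assumes "self_adjoint v" "observable_basis e" "\<xi> \<in> T1"
  shows "gaussian_field e v \<xi> \<in> T0"
  using assms
  by (simp add: gaussian_field_eq_generator T0_def T1_def self_adjoint_gaussian_generator
      trace_gaussian_generator)

theorem proposition10: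
  fixes v :: "complex^'n^'n" and e :: "nat \<Rightarrow> complex^'n^'n"
  assumes "self_adjoint v" and "observable_basis e"
  shows "LaSalle_function (gaussian_field e v) (\<lambda>\<xi>. 1/2 * Re (trace (\<xi> ** \<xi>)))"
  unfolding LaSalle_function_def
proof (intro conjI ballI)
  show "smooth_vector_field (gaussian_field e v)"
    using assms
    by (simp add: smooth_vector_field_def smooth_on_T1_linear linear_gaussian_field
        gaussian_field_in_T0)
  show "complete_vector_field (gaussian_field e v)"
    using global_flow_gaussian_flow[OF assms] by (auto simp: complete_vector_field_def)
  show "preserves_states (gaussian_field e v)"
    unfolding preserves_states_def
  proof (intro allI impI image_subsetI)
    fix \<phi> and t :: real and \<rho> :: "'n cmat"
    assume "global_flow (gaussian_field e v) \<phi>" "0 \<le> t" "\<rho> \<in> states"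
    moreover from this have "\<phi> t \<rho> = gaussian_flow v t \<rho>"
      using global_flow_eq_gaussian_flow[OF assms] states_subset_T1 by blast
    ultimately show "\<phi> t \<rho> \<in> states"
      by (simp add: gaussian_flow_in_states assms)
  qed
  show "smooth_on_T1 (\<lambda>\<xi>::'n cmat. 1/2 * Re (trace (\<xi> ** \<xi>)))"
    by (rule smooth_on_T1_bilinear[OF bounded_bilinear_purity])
next
  fix \<rho> :: "'n cmat"
  assume "\<rho> \<in> states"
  hence \<rho>: "\<rho> \<in> T1" "self_adjoint \<rho>"
    using states_subset_T1 by (auto simp: T1_def)
  \<comment> \<open>For self-adjoint \<open>\<rho>\<close> the trace is the squared norm
    \<open>\<rho> \<bullet> \<rho>\<close>.\<close>
  thus "0 \<le> 1/2 * Re (trace (\<rho> ** \<rho>))"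
    by (simp add: Re_trace_mult_eq_inner self_adjoint_iff)
  show "lie_derivative (gaussian_field e v) (\<lambda>\<xi>. 1/2 * Re (trace (\<xi> ** \<xi>))) \<rho> \<le> 0"
    using assms \<rho> inner_gaussian_generator_nonpos[OF assms(1) \<rho>(2)]
    by (subst lie_derivative_purity)
      (simp_all add: gaussian_field_eq_generator self_adjoint_gaussian_generator)
qed

end
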